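(* Let $C\in[C_-,C_+]$ and let $U$ be an exact solution of the autonomous equation $U_t=\mathcal L(U)$. Assume that $\mathcal L$ is of class $C^4$ in a neighborhood of the exact trajectory. Then, for all sufficiently small $\Delta t>0$, both stage equations of one step started from $U^n=U(t_n)$ are locally uniquely solvable (the first for $U^\star$ near $U(t_n+\Delta t/2)$, the second for $U^{n+1}$ near $U(t_n+\Delta t)$), and the one-step local truncation error is of fifth order: $$U^{n+1}-U(t_n+\Delta t)=O(\Delta t^5)\qquad(\Delta t\to0).$$
   Context: The state $U$ takes values in $\mathbb R^N$, $\mathcal L$ is a vector field, and its trajectory derivative is $\mathcal G(U)=D\mathcal L(U)\,\mathcal L(U)$. Set $C_\pm=\frac{25\pm\sqrt{105}}{780}$, $a_0=\frac16+\frac72C$, $a_1=\frac23-10C$, $a_2=\frac16+\frac{13}{2}C$. One step of the method from $U^n$ with step size $\Delta t$ consists of the two implicit equations, solved successively for $U^\star$ and $U^{n+1}$: $$U^\star=U^n+\tfrac{\Delta t}{4}\bigl[\mathcal L(U^n)+\mathcal L(U^\star)\bigr]+\tfrac{\Delta t^2}{48}\bigl[\mathcal G(U^n)-\mathcal G(U^\star)\bigr],$$ $$U^{n+1}=U^n+\Delta t\bigl[a_0\mathcal L(U^n)+a_1\mathcal L(U^\star)+a_2\mathcal L(U^{n+1})\bigr]+C\Delta t^2\bigl[\mathcal G(U^n)-\mathcal G(U^\star)-\tfrac32\mathcal G(U^{n+1})\bigr].$$ *)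

theory Defs
  imports "HOL-Analysis.Analysis" "HOL-Library.Landau_Symbols"
begin

text \<open>Class C^k on an open set, by recursion on the derivative. In finite dimension a map x to Df(x)
  is of class C^k iff every x to Df(x) v, with v fixed, is; this avoids iterating the type of bounded
  linear maps.\<close>

primrec C_k_on :: "nat \<Rightarrow> ('a::euclidean_space \<Rightarrow> 'b::euclidean_space) \<Rightarrow> 'a set \<Rightarrow> bool" where
  "C_k_on 0 f S \<longleftrightarrow> continuous_on S f"
| "C_k_on (Suc k) f S \<longleftrightarrow>
     (\<forall>x\<in>S. f differentiable (at x)) \<and>
     (\<forall>v. C_k_on k (\<lambda>x. frechet_derivative f (at x) v) S)"

definition traj_deriv :: "(real^'n \<Rightarrow> real^'n) \<Rightarrow> real^'n \<Rightarrow> real^'n" where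
  "traj_deriv L u = frechet_derivative L (at u) (L u)"

definition C_minus :: real where "C_minus = (25 - sqrt 105) / 780"
definition C_plus :: real where "C_plus = (25 + sqrt 105) / 780"

definition a0 :: "real \<Rightarrow> real" where "a0 C = 1/6 + 7/2 * C"
definition a1 :: "real \<Rightarrow> real" where "a1 C = 2/3 - 10 * C"
definition a2 :: "real \<Rightarrow> real" where "a2 C = 1/6 + 13/2 * C"

text \<open>In the two stage equations \<open>h\<close> is the step size, \<open>u\<close> the old value, \<open>us\<close> the intermediate
  value and \<open>un\<close> the new value.\<close>

definition first_stage ::
    "(real^'n \<Rightarrow> real^'n) \<Rightarrow> real \<Rightarrow> real^'n \<Rightarrow> real^'n \<Rightarrow> bool" where
  "first_stage L h u us \<longleftrightarrow>
     us = u + (h / 4) *\<^sub>R (L u + L us)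
            + (h\<^sup>2 / 48) *\<^sub>R (traj_deriv L u - traj_deriv L us)"

definition second_stage ::
    "real \<Rightarrow> (real^'n \<Rightarrow> real^'n) \<Rightarrow> real \<Rightarrow> real^'n \<Rightarrow> real^'n \<Rightarrow> real^'n \<Rightarrow> bool" where
  "second_stage C L h u us un \<longleftrightarrow>
     un = u + h *\<^sub>R (a0 C *\<^sub>R L u + a1 C *\<^sub>R L us + a2 C *\<^sub>R L un)
            + (C * h\<^sup>2) *\<^sub>R (traj_deriv L u - traj_deriv L us - (3/2) *\<^sub>R traj_deriv L un)"

end

theory Submission
  imports Defs
begin

text \<open>Every time derivative of the exact solution is an iterated Lie derivative of \<open>L\<close> evaluated
  along \<open>U\<close>, and a Lie derivative costs one order of differentiability; hence \<open>U\<close> has five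
  continuous derivatives. Both stages are Hermite type quadrature formulas
  for \<open>L\<close> along \<open>U\<close> that are exact for cubic polynomials, so the exact solution satisfies the stage
  equations up to \<open>O(h^5)\<close>. The right-hand side of each stage is a contraction of constant
  \<open>1/2\<close> near \<open>U tn\<close>, which turns a defect of \<open>e\<close> into a fixed point at distance at most
  \<open>2e\<close>. In the second stage the error of the first one enters with a factor \<open>h\<close>.\<close>

section \<open>Calculus of the classes C^k\<close>

lemma C_k_on_has_derivative:
  "C_k_on (Suc k) f S \<Longrightarrow> x \<in> S \<Longrightarrow> (f has_derivative frechet_derivative f (at x)) (at x)"
  by (simp add: frechet_derivative_works)

text \<open>A derivative only sees a neighbourhood of its point, so agreement on an open set passes
  to the derivatives and the induction can go on.\<close>

lemma C_k_on_cong: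
  assumes "open S"
  shows "C_k_on k f S \<Longrightarrow> (\<And>x. x \<in> S \<Longrightarrow> f x = g x) \<Longrightarrow> C_k_on k g S"
proof (induction k arbitrary: f g)
  case 0
  then show ?case by (simp cong: continuous_on_cong)
next
  case (Suc k)
  have eq: "frechet_derivative f (at x) = frechet_derivative g (at x)" if "x \<in> S" for x
    using Suc.prems assms that by (intro frechet_derivative_transform_within_open[of f x S]) auto
  have "g differentiable (at x)" if "x \<in> S" for x
    using has_derivative_transform_within_open[of f _ x UNIV S g, OF C_k_on_has_derivative] Suc.prems assms that
    unfolding differentiable_def by blast
  moreover have "C_k_on k (\<lambda>x. frechet_derivative g (at x) v) S" for v
  proof (rule Suc.IH)
    show "C_k_on k (\<lambda>x. frechet_derivative f (at x) v) S" using Suc.prems(1) by simp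
  qed (simp add: eq)
  ultimately show ?case by simp
qed

text \<open>Frees the closure proofs from \<open>frechet_derivative\<close>: any derivative
  delivered by the differentiation rules will do, since uniqueness identifies the two on
  \<open>S\<close>.\<close>

lemma C_k_on_Suc_intro:
  assumes "open S" and der: "\<And>x. x \<in> S \<Longrightarrow> (f has_derivative f' x) (at x)"
    and C: "\<And>v. C_k_on k (\<lambda>x. f' x v) S"
  shows "C_k_on (Suc k) f S"
proof -
  have "f' x v = frechet_derivative f (at x) v" if "x \<in> S" for x v
    using frechet_derivative_at[OF der[OF that]] by simp
  then have "C_k_on k (\<lambda>x. frechet_derivative f (at x) v) S" for v
    by (intro C_k_on_cong[OF assms(1) C[of v]])
  then show ?thesis using der by (auto simp: differentiable_def)
qed

lemma C_k_on_Suc_imp: "C_k_on (Suc k) f S \<Longrightarrow> C_k_on k f S"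
proof (induction k arbitrary: f)
  case 0
  then show ?case
    by (auto intro!: continuous_at_imp_continuous_on differentiable_imp_continuous_within)
qed auto

lemma C_k_on_mono: "C_k_on k f S \<Longrightarrow> j \<le> k \<Longrightarrow> C_k_on j f S"
  by (induction k) (auto simp: le_Suc_eq simp del: C_k_on.simps dest: C_k_on_Suc_imp)

lemma C_k_on_const: "C_k_on k (\<lambda>x. c) S"
  by (induction k arbitrary: c) auto

lemma C_k_on_add:
  assumes "open S"
  shows "C_k_on k f S \<Longrightarrow> C_k_on k g S \<Longrightarrow> C_k_on k (\<lambda>x. f x + g x) S"
proof (induction k arbitrary: f g)
  case 0
  then show ?case by (auto intro: continuous_intros)
next
  case (Suc k)
  note der = C_k_on_has_derivative[OF Suc.prems(1)] C_k_on_has_derivative[OF Suc.prems(2)]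
  show ?case
    by (rule C_k_on_Suc_intro[OF assms has_derivative_add[OF der] Suc.IH])
       (use Suc.prems in auto)
qed

lemma C_k_on_sum:
  assumes "open S" "\<And>i. i \<in> A \<Longrightarrow> C_k_on k (f i) S"
  shows "C_k_on k (\<lambda>x. \<Sum>i\<in>A. f i x) S"
  using assms(2)
  by (induction A rule: infinite_finite_induct) (auto intro: C_k_on_const C_k_on_add[OF assms(1)])

text \<open>Each term of the product rule keeps one factor undifferentiated; that factor has an
  order to spare and is lowered with \<open>C_k_on_Suc_imp\<close> before the induction hypothesis
  applies.\<close>

lemma C_k_on_scaleR:
  assumes "open S"
  shows "C_k_on k f S \<Longrightarrow> C_k_on k g S \<Longrightarrow> C_k_on k (\<lambda>x. f x *\<^sub>R g x) S"
proof (induction k arbitrary: f g)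
  case 0
  then show ?case by (auto intro: continuous_intros)
next
  case (Suc k)
  note der = C_k_on_has_derivative[OF Suc.prems(1)] C_k_on_has_derivative[OF Suc.prems(2)]
  show ?case
    by (rule C_k_on_Suc_intro[OF assms has_derivative_scaleR[OF der] C_k_on_add[OF assms]])
       (use Suc.prems C_k_on_Suc_imp in \<open>auto intro!: Suc.IH simp del: C_k_on.simps, auto\<close>)
qed

lemma C_k_on_inner_left:
  assumes "open S"
  shows "C_k_on k f S \<Longrightarrow> C_k_on k (\<lambda>x. f x \<bullet> e) S"
proof (induction k arbitrary: f)
  case 0
  then show ?case by (auto intro: continuous_intros)
next
  case (Suc k)
  show ?case
    by (rule C_k_on_Suc_intro[OF assms
          has_derivative_inner_left[OF C_k_on_has_derivative[OF Suc.prems]] Suc.IH])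
       (use Suc.prems in auto)
qed

text \<open>Mean value inequality on a compact convex set. \<open>C_k_on\<close> gives continuity of
  the derivative only in each fixed direction, so the operator norm is bounded through the finitely
  many basis directions.\<close>

lemma C_k_on_lipschitz:
  assumes f: "C_k_on (Suc k) f S" and K: "compact K" "convex K" "K \<subseteq> S"
  obtains B where "B-lipschitz_on K f"
proof -
  have "\<exists>M. \<forall>x\<in>K. norm (frechet_derivative f (at x) i) \<le> M" for i
  proof -
    have "continuous_on S (\<lambda>x. frechet_derivative f (at x) i)"
      using C_k_on_mono[of k _ S 0] f by auto
    then have "bounded ((\<lambda>x. frechet_derivative f (at x) i) ` K)"
      by (intro compact_imp_bounded compact_continuous_image continuous_on_subset[OF _ K(3)] K)
    then show ?thesis by (auto simp: bounded_iff)
  qed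
  then obtain M where M: "\<And>i x. x \<in> K \<Longrightarrow> norm (frechet_derivative f (at x) i) \<le> M i"
    by metis
  \<comment> \<open>The absolute values keep \<open>B\<close> nonnegative even if \<open>K\<close>
    is empty and nothing is known about \<open>M\<close>.\<close>
  define B where "B = (\<Sum>i\<in>Basis. \<bar>M i\<bar>)"
  have B0: "0 \<le> B" by (simp add: B_def sum_nonneg)
  have der: "(f has_derivative frechet_derivative f (at x)) (at x)" if "x \<in> K" for x
    using C_k_on_has_derivative[OF f] K(3) that by blast
  have on: "onorm (frechet_derivative f (at x)) \<le> B" if "x \<in> K" for x
  proof (rule onorm_bound[OF B0])
    fix v
    have lin: "linear (frechet_derivative f (at x))"
      using der[OF that] by (rule has_derivative_linear)
    have "norm (frechet_derivative f (at x) v)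
        = norm (\<Sum>i\<in>Basis. (v \<bullet> i) *\<^sub>R frechet_derivative f (at x) i)"
      by (subst euclidean_representation[of v, symmetric])
         (simp add: linear_sum[OF lin] linear_cmul[OF lin])
    also have "\<dots> \<le> (\<Sum>i\<in>Basis. \<bar>M i\<bar> * norm v)"
    proof (rule sum_norm_le)
      fix i :: 'a assume i: "i \<in> Basis"
      have "norm (frechet_derivative f (at x) i) \<le> \<bar>M i\<bar>"
        using M[OF that, of i] by linarith
      then show "norm ((v \<bullet> i) *\<^sub>R frechet_derivative f (at x) i) \<le> \<bar>M i\<bar> * norm v"
        using Basis_le_norm[OF i, of v]
        by (subst mult.commute) (auto intro!: mult_mono)
    qed
    finally show "norm (frechet_derivative f (at x) v) \<le> B * norm v"
      by (simp add: B_def sum_distrib_right)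
  qed
  have "B-lipschitz_on K f"
    by (rule lipschitz_onI)
       (auto simp: dist_norm B0 intro!: differentiable_bound[OF K(2) has_derivative_at_withinI[OF der] on])
  then show ?thesis ..
qed

section \<open>Derivatives along a trajectory\<close>

text \<open>Keeping \<open>f\<close> separate from \<open>L\<close> permits iteration: along a
  solution, and for smooth enough \<open>L\<close>, \<open>(lie_deriv L ^^ m) L\<close> is the time
  derivative of order m + 1; \<open>traj_deriv L\<close> is the case m = 1.\<close>

definition lie_deriv :: "('a::euclidean_space \<Rightarrow> 'a) \<Rightarrow> ('a \<Rightarrow> 'b::euclidean_space) \<Rightarrow> 'a \<Rightarrow> 'b" where
  "lie_deriv L f x = frechet_derivative f (at x) (L x)"

text \<open>The direction \<open>L x\<close> moves with \<open>x\<close>, while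
  \<open>C_k_on\<close> speaks of fixed directions. Expanding \<open>L x\<close> in the basis leaves
  products of coordinates of \<open>L\<close> with derivatives in fixed directions.\<close>

lemma C_k_on_lie_deriv:
  assumes "open S" "C_k_on k L S" and f: "C_k_on (Suc k) f S"
  shows "C_k_on k (lie_deriv L f) S"
proof (rule C_k_on_cong[OF assms(1)])
  show "C_k_on k (\<lambda>x. \<Sum>i\<in>Basis. (L x \<bullet> i) *\<^sub>R frechet_derivative f (at x) i) S"
    using f by (intro C_k_on_sum C_k_on_scaleR C_k_on_inner_left assms) simp
  show "(\<Sum>i\<in>Basis. (L x \<bullet> i) *\<^sub>R frechet_derivative f (at x) i) = lie_deriv L f x" if "x \<in> S" for x
  proof -
    have lin: "linear (frechet_derivative f (at x))"
      using C_k_on_has_derivative[OF f that] by (rule has_derivative_linear)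
    show ?thesis
      unfolding lie_deriv_def
      by (subst (2) euclidean_representation[of "L x", symmetric])
         (simp add: linear_sum[OF lin] linear_cmul[OF lin])
  qed
qed

lemma C_k_on_lie_deriv_funpow:
  assumes "open S" "C_k_on k L S"
  shows "m \<le> k \<Longrightarrow> C_k_on (k - m) ((lie_deriv L ^^ m) L) S"
proof (induction m)
  case (Suc m)
  then show ?case
    using C_k_on_mono[OF assms(2)]
    by (auto simp del: C_k_on.simps simp: Suc_diff_Suc intro!: C_k_on_lie_deriv[OF assms(1)])
qed (simp add: assms)

lemma has_vector_derivative_lie_deriv:
  assumes "(U has_vector_derivative L (U t)) (at t within T)"
    and "(f has_derivative frechet_derivative f (at (U t))) (at (U t))"
  shows "((\<lambda>s. f (U s)) has_vector_derivative lie_deriv L f (U t)) (at t within T)"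
  using vector_derivative_diff_chain_within[OF assms(1) has_derivative_at_withinI[OF assms(2)]]
  by (simp add: o_def lie_deriv_def)

section \<open>Taylor expansion of a chain of derivatives\<close>

text \<open>Taylor's formula with integral remainder for the whole chain at once: every expansion
  stops where the remainder contains \<open>W p\<close>, so one bound on \<open>W p\<close> serves
  all \<open>m\<close>.\<close>

lemma Taylor_chain_bound:
  fixes W :: "nat \<Rightarrow> real \<Rightarrow> 'a::banach"
  assumes W: "\<And>m t. m < p \<Longrightarrow> t \<in> {a..b} \<Longrightarrow>
      (W m has_vector_derivative W (Suc m) t) (at t within {a..b})"
    and cont: "continuous_on {a..b} (W p)"
  shows "\<exists>M\<ge>0. \<forall>m<p. \<forall>s\<in>{0..b - a}.
      norm (W m (a + s) - (\<Sum>i<p - m. (s ^ i / fact i) *\<^sub>R W (m + i) a)) \<le> M * s ^ (p - m)"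
proof -
  have "bounded (W p ` {a..b})"
    using cont by (intro compact_imp_bounded compact_continuous_image) auto
  then obtain M where M: "0 < M" "\<And>t. t \<in> {a..b} \<Longrightarrow> norm (W p t) \<le> M"
    by (auto simp: bounded_pos)
  have "norm (W m (a + s) - (\<Sum>i<p - m. (s ^ i / fact i) *\<^sub>R W (m + i) a)) \<le> M * s ^ (p - m)"
    if m: "m < p" and s: "0 \<le> s" "s \<le> b - a" for m s
  proof -
    \<comment> \<open>The integrand carries the power \<open>q\<close>, one less than
      \<open>p - m\<close>; the length \<open>s\<close> of the interval supplies the missing
      factor.\<close>
    define q where "q = p - Suc m"
    have pq: "p - m = Suc q" "m + Suc q = p" using m by (auto simp: q_def)
    have "(W (m + j) has_vector_derivative W (Suc (m + j)) t) (at t within {a..a + s})"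
      if "j < Suc q" "a \<le> t" "t \<le> a + s" for j t
      by (rule has_vector_derivative_within_subset[OF W]) (use that s pq in auto)
    then have "((\<lambda>x. ((a + s - x) ^ q / fact q) *\<^sub>R W (m + Suc q) x) has_integral
        W m (a + s) - (\<Sum>i<Suc q. ((a + s - a) ^ i / fact i) *\<^sub>R W (m + i) a)) (cbox a (a + s))"
      using s Taylor_has_integral[of "Suc q" "\<lambda>i. W (m + i)" "W m" a "a + s"]
      by (simp del: sum.lessThan_Suc)
    then have "norm (W m (a + s) - (\<Sum>i<Suc q. ((a + s - a) ^ i / fact i) *\<^sub>R W (m + i) a))
        \<le> (s ^ q * M) * measure lborel (cbox a (a + s))"
    proof (rule has_integral_bound[rotated])
      show "0 \<le> s ^ q * M" using s M by simp
      fix x assume x: "x \<in> cbox a (a + s)"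
      have "(a + s - x) ^ q / fact q \<le> (a + s - x) ^ q"
        using x by (auto simp: divide_le_eq mult_le_cancel_left1 fact_ge_1)
      also have "\<dots> \<le> s ^ q" using x by (intro power_mono) auto
      finally show "norm (((a + s - x) ^ q / fact q) *\<^sub>R W (m + Suc q) x) \<le> s ^ q * M"
        using M(2)[of x] x s pq(2) by (simp only: norm_scaleR, intro mult_mono) auto
    qed
    then show ?thesis using s by (simp add: pq mult_ac del: sum.lessThan_Suc)
  qed
  then show ?thesis using M(1) by (intro exI[of _ M]) auto
qed

section \<open>Implicit equations depending on a parameter\<close>

text \<open>With contraction constant 1/2 and residual \<open>e\<close>, the closed ball of radius
  \<open>2 * e\<close> about \<open>y\<close> is mapped into itself, because e + (2e)/2 = 2e. The
  same \<open>X\<close> works for every \<open>r\<close>; the radius only decides from where on the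
  uniqueness holds.\<close>

lemma perturbed_fixed_point:
  fixes \<Phi> :: "'p \<Rightarrow> 'a::banach \<Rightarrow> 'a"
  assumes R: "0 < R"
    and y: "(y \<longlongrightarrow> z) F"
    and lip: "\<forall>\<^sub>F h in F. (1/2)-lipschitz_on (cball z R) (\<Phi> h)"
    and res: "\<forall>\<^sub>F h in F. norm (\<Phi> h (y h) - y h) \<le> e h"
    and e: "(e \<longlongrightarrow> 0) F"
  obtains X where
    "\<And>r. 0 < r \<Longrightarrow> r \<le> R/2 \<Longrightarrow> \<forall>\<^sub>F h in F. {x \<in> ball (y h) r. x = \<Phi> h x} = {X h}"
    "\<forall>\<^sub>F h in F. norm (X h - y h) \<le> 2 * e h"
proof -
  define X where "X h = (SOME x. x \<in> cball (y h) (2 * e h) \<and> \<Phi> h x = x)" for h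
  \<comment> \<open>\<open>e h < r/2\<close> puts the closed ball of radius \<open>2 * e h\<close>
    inside \<open>ball (y h) r\<close>; the distance bound and \<open>r \<le> R/2\<close> put the
    latter inside \<open>cball z R\<close>, where the contraction estimate holds.\<close>
  define good where "good r h \<longleftrightarrow> dist (y h) z < R/2 \<and> (1/2)-lipschitz_on (cball z R) (\<Phi> h)
      \<and> norm (\<Phi> h (y h) - y h) \<le> e h \<and> e h < r/2" for r h
  have ev: "\<forall>\<^sub>F h in F. good r h" if "0 < r" for r
    unfolding good_def using R that
    by (intro eventually_conj lip res tendstoD[OF y] order_tendstoD[OF e]) auto
  have X: "X h \<in> cball (y h) (2 * e h) \<and> \<Phi> h (X h) = X h"
    and unique: "{x \<in> ball (y h) r. x = \<Phi> h x} = {X h}"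
    if r: "0 < r" "r \<le> R/2" and g: "good r h" for r h
  proof -
    have e0: "0 \<le> e h" using g norm_ge_zero order_trans unfolding good_def by blast
    have sub: "ball (y h) r \<subseteq> cball z R"
    proof
      fix x assume "x \<in> ball (y h) r"
      then show "x \<in> cball z R"
        using g r dist_triangle[of z x "y h"] by (auto simp: good_def dist_commute)
    qed
    have sub': "cball (y h) (2 * e h) \<subseteq> ball (y h) r" using g by (auto simp: good_def)
    have lip': "dist (\<Phi> h x) (\<Phi> h x') \<le> 1/2 * dist x x'"
      if "x \<in> ball (y h) r" "x' \<in> ball (y h) r" for x x'
      using g lipschitz_onD[of "1/2" "cball z R" "\<Phi> h" x x'] subsetD[OF sub that(1)] subsetD[OF sub that(2)]
      unfolding good_def by blast
    have "\<exists>!x\<in>cball (y h) (2 * e h). \<Phi> h x = x"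
    proof (rule Banach_fix[of _ "1/2"])
      show "\<Phi> h ` cball (y h) (2 * e h) \<subseteq> cball (y h) (2 * e h)"
      proof safe
        fix x assume x: "x \<in> cball (y h) (2 * e h)"
        have "dist (y h) (\<Phi> h x) \<le> dist (y h) (\<Phi> h (y h)) + dist (\<Phi> h (y h)) (\<Phi> h x)"
          by (rule dist_triangle)
        also have "\<dots> \<le> e h + 1/2 * dist (y h) x"
          using g x sub' r
          by (intro add_mono lip') (auto simp: good_def dist_norm norm_minus_commute)
        finally show "\<Phi> h x \<in> cball (y h) (2 * e h)" using x by simp
      qed
      show "complete (cball (y h) (2 * e h))" by (simp add: complete_eq_closed)
      show "dist (\<Phi> h x) (\<Phi> h x') \<le> 1/2 * dist x x'"
        if "x \<in> cball (y h) (2 * e h)" "x' \<in> cball (y h) (2 * e h)" for x x'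
        using that sub' by (intro lip') blast+
    qed (use e0 in auto)
    then show X: "X h \<in> cball (y h) (2 * e h) \<and> \<Phi> h (X h) = X h"
      unfolding X_def by (intro someI_ex[of "\<lambda>x. x \<in> cball (y h) (2 * e h) \<and> \<Phi> h x = x"]) blast
    have "X h \<in> ball (y h) r" "X h = \<Phi> h (X h)" using X sub' by auto
    moreover have "x = X h" if "x \<in> ball (y h) r" "x = \<Phi> h x" for x
    proof -
      have "dist x (X h) \<le> 1/2 * dist x (X h)"
        using lip'[of x "X h"] X sub' that by auto
      then show ?thesis using zero_le_dist[of x "X h"] by simp
    qed
    ultimately show "{x \<in> ball (y h) r. x = \<Phi> h x} = {X h}" by blast
  qed
  show ?thesis
  proof (rule that)
    show "\<forall>\<^sub>F h in F. {x \<in> ball (y h) r. x = \<Phi> h x} = {X h}" if "0 < r" "r \<le> R/2" for r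
      using ev[OF that(1)] by eventually_elim (rule unique[OF that])
    show "\<forall>\<^sub>F h in F. norm (X h - y h) \<le> 2 * e h"
      using ev[of "R/2"]
    proof (rule eventually_mono)
      show "norm (X h - y h) \<le> 2 * e h" if "good (R/2) h" for h
        using X[of "R/2" h] that R by (simp add: dist_norm norm_minus_commute)
    qed (use R in simp)
  qed
qed

text \<open>Every term in \<open>x\<close> carries a factor \<open>h\<close> or
  \<open>h\<^sup>2\<close>, so the Lipschitz constant tends to 0 with \<open>h\<close>;
  \<open>w h\<close> collects the explicit terms of a stage.\<close>

lemma eventually_lipschitz_step:
  fixes f g :: "'a::real_normed_vector \<Rightarrow> 'a"
  assumes f: "B-lipschitz_on K f" and g: "B-lipschitz_on K g"
  shows "\<forall>\<^sub>F h in at_right (0::real).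
    (1/2)-lipschitz_on K (\<lambda>x. w h + (a * h) *\<^sub>R f x + (b * h\<^sup>2) *\<^sub>R g x)"
proof -
  have "((\<lambda>h. \<bar>a * h\<bar> * B + \<bar>b * h\<^sup>2\<bar> * B) \<longlongrightarrow> \<bar>a * 0\<bar> * B + \<bar>b * 0\<^sup>2\<bar> * B) (at_right (0::real))"
    by (intro tendsto_intros)
  then have "\<forall>\<^sub>F h in at_right (0::real). \<bar>a * h\<bar> * B + \<bar>b * h\<^sup>2\<bar> * B < 1/2"
    by (intro order_tendstoD(2)) auto
  then show ?thesis
  proof eventually_elim
    case (elim h)
    have "(0 + \<bar>a * h\<bar> * B + \<bar>b * h\<^sup>2\<bar> * B)-lipschitz_on K
        (\<lambda>x. w h + (a * h) *\<^sub>R f x + (b * h\<^sup>2) *\<^sub>R g x)"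
      by (intro lipschitz_on_add lipschitz_on_cmult lipschitz_on_constant f g)
    then show ?case by (rule lipschitz_on_mono) (use elim in auto)
  qed
qed

section \<open>The two quadrature formulas\<close>

context
  fixes W :: "nat \<Rightarrow> real \<Rightarrow> real^'n" and a b M :: real
  assumes M: "0 \<le> M"
    and Taylor: "\<forall>m<5. \<forall>s\<in>{0..b - a}.
      norm (W m (a + s) - (\<Sum>i<5 - m. (s ^ i / fact i) *\<^sub>R W (m + i) a)) \<le> M * s ^ (5 - m)"
begin

text \<open>In the stage formulas \<open>W m\<close> has a coefficient proportional to h^m.
  Weighting the Taylor remainders by this power gives all of them the common size h^5.\<close>

definition scaled_remainder :: "real \<Rightarrow> nat \<Rightarrow> real \<Rightarrow> real^'n" where
  "scaled_remainder h m s =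
     h ^ m *\<^sub>R (W m (a + s) - (\<Sum>i<5 - m. (s ^ i / fact i) *\<^sub>R W (m + i) a))"

lemma scaled_remainder_le:
  assumes "m < 5" "0 \<le> s" "s \<le> h" "h \<le> b - a"
  shows "norm (scaled_remainder h m s) \<le> M * h ^ 5"
proof -
  have "norm (scaled_remainder h m s) \<le> h ^ m * (M * s ^ (5 - m))"
    using assms Taylor by (auto simp: scaled_remainder_def intro!: mult_left_mono)
  also have "\<dots> \<le> h ^ m * (M * h ^ (5 - m))"
    using assms M by (intro mult_left_mono power_mono) auto
  also have "\<dots> = M * h ^ 5"
    using assms by (simp flip: power_add add: mult_ac)
  finally show ?thesis .
qed

text \<open>Trapezoidal rule with end correction: for k = h/2 the weights are k/2 and k^2/12. The
  factor 3 is a round bound for 1 + 1/4 + 1/48.\<close>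

lemma first_quadrature:
  assumes "0 \<le> h" "h \<le> b - a"
  shows "norm (W 0 a + (h / 4) *\<^sub>R (W 1 a + W 1 (a + h/2))
      + (h\<^sup>2 / 48) *\<^sub>R (W 2 a - W 2 (a + h/2)) - W 0 (a + h/2)) \<le> 3 * M * h ^ 5"
    (is "norm ?d \<le> _")
proof -
  let ?e = "scaled_remainder h"
  \<comment> \<open>Componentwise a polynomial identity in \<open>h\<close>: the Taylor polynomials
    of degrees 4, 3 and 2 cancel. Values at \<open>a\<close> leave no remainder because
    \<open>a\<close> is the base point.\<close>
  have eq: "?d = (1/4) *\<^sub>R ?e 1 (h/2) - (1/48) *\<^sub>R ?e 2 (h/2) - ?e 0 (h/2)"
    by (simp add: vec_eq_iff scaled_remainder_def eval_nat_numeral field_simps)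
  have "norm ?d \<le> 1/4 * norm (?e 1 (h/2)) + 1/48 * norm (?e 2 (h/2)) + norm (?e 0 (h/2))"
    unfolding eq by (intro order_trans[OF norm_triangle_ineq4] add_mono) auto
  also have "\<dots> \<le> 1/4 * (M * h ^ 5) + 1/48 * (M * h ^ 5) + M * h ^ 5"
    using assms by (intro add_mono mult_left_mono scaled_remainder_le) auto
  also have "\<dots> \<le> 3 * M * h ^ 5"
    using assms M by (simp add: zero_le_mult_iff)
  finally show ?thesis .
qed

text \<open>Simpson's rule, which is the case C = 0, plus \<open>C\<close> times a combination that
  vanishes on cubics; the weights reproduce the moments 1, 1/2, 1/3, 1/4 of the unit
  interval.\<close>

lemma second_quadrature:
  assumes "0 \<le> h" "h \<le> b - a"
  shows "norm (W 0 a + h *\<^sub>R (a0 C *\<^sub>R W 1 a + a1 C *\<^sub>R W 1 (a + h/2) + a2 C *\<^sub>R W 1 (a + h))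
      + (C * h\<^sup>2) *\<^sub>R (W 2 a - W 2 (a + h/2) - (3/2) *\<^sub>R W 2 (a + h)) - W 0 (a + h))
    \<le> (\<bar>a1 C\<bar> + \<bar>a2 C\<bar> + \<bar>C\<bar> + \<bar>3/2 * C\<bar> + 1) * M * h ^ 5"
    (is "norm ?d \<le> _")
proof -
  let ?e = "scaled_remainder h"
  have eq: "?d = a1 C *\<^sub>R ?e 1 (h/2) + a2 C *\<^sub>R ?e 1 h - C *\<^sub>R ?e 2 (h/2) - (3/2 * C) *\<^sub>R ?e 2 h - ?e 0 h"
    by (simp add: vec_eq_iff scaled_remainder_def a0_def a1_def a2_def eval_nat_numeral field_simps)
  have "norm ?d \<le> \<bar>a1 C\<bar> * norm (?e 1 (h/2)) + \<bar>a2 C\<bar> * norm (?e 1 h)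
      + \<bar>C\<bar> * norm (?e 2 (h/2)) + \<bar>3/2 * C\<bar> * norm (?e 2 h) + norm (?e 0 h)"
    unfolding eq by (intro order_trans[OF norm_triangle_ineq4] order_trans[OF norm_triangle_ineq] add_mono) auto
  also have "\<dots> \<le> \<bar>a1 C\<bar> * (M * h ^ 5) + \<bar>a2 C\<bar> * (M * h ^ 5)
      + \<bar>C\<bar> * (M * h ^ 5) + \<bar>3/2 * C\<bar> * (M * h ^ 5) + M * h ^ 5"
    using assms by (intro add_mono mult_left_mono scaled_remainder_le) auto
  finally show ?thesis by (simp only: distrib_right mult.assoc mult_1)
qed

end

theorem theorem1:
  fixes L :: "real^'n \<Rightarrow> real^'n" and U :: "real \<Rightarrow> real^'n"
    and I :: "real set" and S :: "(real^'n) set" and C tn t1 :: real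
  assumes C: "C \<in> {C_minus..C_plus}"
    and I: "is_interval I" "tn \<in> I" "t1 \<in> I" "tn < t1"
    and U: "\<And>t. t \<in> I \<Longrightarrow> (U has_vector_derivative L (U t)) (at t within I)"
    and S: "open S" "U ` I \<subseteq> S"
    and L: "C_k_on 4 L S"
  shows "\<exists>r0>0. \<exists>Ustar Unew :: real \<Rightarrow> real^'n.
           (\<forall>\<^sub>F h in at_right 0. ball (U (tn + h/2)) r0 \<subseteq> S \<and> ball (U (tn + h)) r0 \<subseteq> S) \<and>
           (\<forall>r\<in>{0<..r0}. \<forall>\<^sub>F h in at_right 0.
              {us \<in> ball (U (tn + h/2)) r. first_stage L h (U tn) us} = {Ustar h} \<and>
              {un \<in> ball (U (tn + h)) r. second_stage C L h (U tn) (Ustar h) un} = {Unew h}) \<and>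
           (\<lambda>h. norm (Unew h - U (tn + h))) \<in> O[at_right 0](\<lambda>h. h ^ 5)"
proof -

  \<comment> \<open>Time derivatives of the exact solution up to order five\<close>
  let ?D = "lie_deriv L" and ?G = "traj_deriv L"
  have G: "?G = ?D L" by (simp add: fun_eq_iff traj_deriv_def lie_deriv_def)
  have sub: "{tn..t1} \<subseteq> I"
    using mem_is_interval_1_I[OF I(1-3)] by auto
  have U': "(U has_vector_derivative L (U t)) (at t within {tn..t1})" "U t \<in> S"
    if "t \<in> {tn..t1}" for t
    using has_vector_derivative_within_subset[OF U sub] subsetD[OF sub that] S(2) by auto
  have contU: "continuous_on {tn..t1} U"
    using U'(1) by (rule continuous_on_vector_derivative)
  have Dm: "C_k_on (4 - m) ((?D ^^ m) L) S" if "m \<le> 4" for m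
    by (rule C_k_on_lie_deriv_funpow[OF S(1) L that])

  \<comment> \<open>The index counts time derivatives of \<open>U\<close>. As U' = L(U) is already
    the first, \<open>Suc j\<close> carries \<open>j\<close> Lie derivatives; \<open>W 5\<close>
    takes four of them, and its continuity uses up the class C^4.\<close>
  define W where "W m = (case m of 0 \<Rightarrow> U | Suc j \<Rightarrow> (\<lambda>t. (?D ^^ j) L (U t)))" for m
  have W012: "W 0 = U" "W 1 = (\<lambda>t. L (U t))" "W 2 = (\<lambda>t. ?G (U t))"
    by (auto simp: W_def G eval_nat_numeral)
  have "(W m has_vector_derivative W (Suc m) t) (at t within {tn..t1})"
    if "m < 5" "t \<in> {tn..t1}" for m t
  proof (cases m)
    case 0
    then show ?thesis using U'(1)[OF that(2)] by (simp add: W_def)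
  next
    case (Suc j)
    have "C_k_on (Suc (3 - j)) ((?D ^^ j) L) S"
      using C_k_on_mono[OF Dm[of j]] that Suc by (simp del: C_k_on.simps)
    note der = C_k_on_has_derivative[OF this U'(2)[OF that(2)]]
    show ?thesis
      using has_vector_derivative_lie_deriv[where U = U and L = L, OF U'(1)[OF that(2)] der]
      by (simp add: W_def Suc)
  qed
  moreover have "continuous_on {tn..t1} (W 5)"
    using continuous_on_compose2[OF _ contU image_subsetI[OF U'(2)], of "(?D ^^ 4) L"] Dm[of 4]
    by (simp add: W_def)
  ultimately have "\<exists>M\<ge>0. \<forall>m<5. \<forall>s\<in>{0..t1 - tn}.
      norm (W m (tn + s) - (\<Sum>i<5 - m. (s ^ i / fact i) *\<^sub>R W (m + i) tn)) \<le> M * s ^ (5 - m)"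
    by (rule Taylor_chain_bound)
  then obtain M where M: "0 \<le> M" and Taylor: "\<forall>m<5. \<forall>s\<in>{0..t1 - tn}.
      norm (W m (tn + s) - (\<Sum>i<5 - m. (s ^ i / fact i) *\<^sub>R W (m + i) tn)) \<le> M * s ^ (5 - m)"
    by (elim exE conjE) (rule that)
  note quadrature1 = first_quadrature[OF M Taylor, unfolded W012]
    and quadrature2 = second_quadrature[OF M Taylor, unfolded W012]

  \<comment> \<open>Common Lipschitz constant near the initial value\<close>
  obtain R where R: "0 < R" "cball (U tn) R \<subseteq> S"
    using S I open_contains_cball by blast
  then have half_pos: "0 < R/2" by simp
  let ?K = "cball (U tn) R"
  have "C_k_on (Suc 0) L S" "C_k_on (Suc 0) ?G S"
    using C_k_on_mono[OF L, of "Suc 0"] C_k_on_mono[OF Dm[of 1], of "Suc 0"] by (auto simp: G)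
  then obtain B1 B2 where "B1-lipschitz_on ?K L" "B2-lipschitz_on ?K ?G"
    using C_k_on_lipschitz[OF _ compact_cball convex_cball R(2)] by metis
  then have "(max B1 B2)-lipschitz_on ?K L" "(max B1 B2)-lipschitz_on ?K ?G"
    by (auto intro: lipschitz_on_le)
  then obtain B where B: "B-lipschitz_on ?K L" "B-lipschitz_on ?K ?G" ..
  have B0: "0 \<le> B" using B(1) by (rule lipschitz_on_nonneg)

  \<comment> \<open>Limits as the step size tends to zero\<close>
  have small: "\<forall>\<^sub>F h in at_right (0::real). 0 < h \<and> h \<le> 1 \<and> h \<le> t1 - tn"
    using I(4) by (intro eventually_at_rightI[of 0 "min 1 (t1 - tn)"]) auto
  have "(U \<longlongrightarrow> U tn) (at tn within {tn..t1})"
    using contU I(4) by (auto simp: continuous_on_def)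
  \<comment> \<open>\<open>c = 1/2\<close> and \<open>c = 1\<close> give the midpoint and the end of
    the step. The limit is taken within \<open>{tn..t1}\<close>, so the shifted times must lie there
    and differ from \<open>tn\<close>.\<close>
  then have limU: "((\<lambda>h. U (tn + c * h)) \<longlongrightarrow> U tn) (at_right 0)" if "0 < c" "c \<le> 1" for c
  proof (rule filterlim_compose)
    have "((\<lambda>h. tn + c * h) \<longlongrightarrow> tn + c * 0) (at_right 0)"
      by (intro tendsto_intros)
    moreover have "\<forall>\<^sub>F h in at_right 0. tn + c * h \<in> {tn..t1} \<and> tn + c * h \<noteq> tn"
      using small
    proof eventually_elim
      case (elim h)
      then have "c * h \<le> 1 * h" "0 < c * h"
        using that by (auto intro!: mult_right_mono)
      then have "tn + c * h \<le> t1" "tn < tn + c * h" using elim by linarith+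
      then show ?case unfolding atLeastAtMost_iff by linarith
    qed
    ultimately show "filterlim (\<lambda>h. tn + c * h) (at tn within {tn..t1}) (at_right 0)"
      by (auto simp: filterlim_at)
  qed
  have lim_half: "((\<lambda>h. U (tn + h/2)) \<longlongrightarrow> U tn) (at_right 0)"
    and lim_full: "((\<lambda>h. U (tn + h)) \<longlongrightarrow> U tn) (at_right 0)"
    using limU[of "1/2"] limU[of 1] by auto
  have lim5: "((\<lambda>h. K * h ^ 5) \<longlongrightarrow> 0) (at_right (0::real))" for K
    by (auto intro!: tendsto_eq_intros)

  \<comment> \<open>First stage: a fixed point near the midpoint value\<close>
  define \<Phi> where "\<Phi> h x = (U tn + (h/4) *\<^sub>R L (U tn) + (h\<^sup>2/48) *\<^sub>R ?G (U tn))
      + (1/4 * h) *\<^sub>R L x + (- 1/48 * h\<^sup>2) *\<^sub>R ?G x" for h x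
  \<comment> \<open>The definition splits off the explicit terms for the Lipschitz estimate; this
    form displays the stage equation.\<close>
  have \<Phi>: "\<Phi> h x = U tn + (h/4) *\<^sub>R (L (U tn) + L x) + (h\<^sup>2/48) *\<^sub>R (?G (U tn) - ?G x)" for h x
    by (simp add: \<Phi>_def algebra_simps)
  then have stage1: "first_stage L h (U tn) x \<longleftrightarrow> x = \<Phi> h x" for h x
    by (simp add: first_stage_def)
  have "\<forall>\<^sub>F h in at_right 0. (1/2)-lipschitz_on ?K (\<Phi> h)"
    unfolding \<Phi>_def by (rule eventually_lipschitz_step[OF B])
  moreover have "\<forall>\<^sub>F h in at_right 0. norm (\<Phi> h (U (tn + h/2)) - U (tn + h/2)) \<le> 3 * M * h ^ 5"
    using small by eventually_elim (use quadrature1 in \<open>auto simp: \<Phi>\<close>)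
  ultimately obtain Ustar where
    Ustar: "\<And>r. 0 < r \<Longrightarrow> r \<le> R/2 \<Longrightarrow>
      \<forall>\<^sub>F h in at_right 0. {x \<in> ball (U (tn + h/2)) r. x = \<Phi> h x} = {Ustar h}" and
    Ustar_err: "\<forall>\<^sub>F h in at_right 0. norm (Ustar h - U (tn + h/2)) \<le> 2 * (3 * M * h ^ 5)"
    using perturbed_fixed_point[OF R(1) lim_half _ _ lim5] by blast

  \<comment> \<open>Second stage, fed with the computed intermediate value\<close>
  define \<Psi> where "\<Psi> h x = (U tn + h *\<^sub>R (a0 C *\<^sub>R L (U tn) + a1 C *\<^sub>R L (Ustar h))
        + (C * h\<^sup>2) *\<^sub>R (?G (U tn) - ?G (Ustar h)))
      + (a2 C * h) *\<^sub>R L x + (- 3/2 * C * h\<^sup>2) *\<^sub>R ?G x" for h x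
  have \<Psi>: "\<Psi> h x = U tn + h *\<^sub>R (a0 C *\<^sub>R L (U tn) + a1 C *\<^sub>R L (Ustar h) + a2 C *\<^sub>R L x)
        + (C * h\<^sup>2) *\<^sub>R (?G (U tn) - ?G (Ustar h) - (3/2) *\<^sub>R ?G x)" for h x
    by (simp add: \<Psi>_def algebra_simps)
  then have stage2: "second_stage C L h (U tn) (Ustar h) x \<longleftrightarrow> x = \<Psi> h x" for h x
    by (simp add: second_stage_def)
  \<comment> \<open>\<open>A\<close> is the constant of \<open>second_quadrature\<close>. The second
    summand of \<open>N\<close> pays for using \<open>Ustar h\<close> instead of the exact midpoint
    value: \<open>B\<close> times the first-stage error 6 M h^5, weighted by \<open>a1 C\<close> and
    \<open>C\<close>, with the additional factors h and h^2 bounded by 1.\<close>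
  define A where "A = \<bar>a1 C\<bar> + \<bar>a2 C\<bar> + \<bar>C\<bar> + \<bar>3/2 * C\<bar> + 1"
  define N where "N = A * M + (\<bar>a1 C\<bar> + \<bar>C\<bar>) * B * (6 * M)"
  have "\<forall>\<^sub>F h in at_right 0. (1/2)-lipschitz_on ?K (\<Psi> h)"
    unfolding \<Psi>_def by (rule eventually_lipschitz_step[OF B])
  \<comment> \<open>Local uniqueness at radius \<open>R/2\<close> also yields membership:
    \<open>Ustar h\<close> is within \<open>R/2\<close> of the midpoint value, hence in
    \<open>?K\<close>, where the Lipschitz bounds are available.\<close>
  moreover have "\<forall>\<^sub>F h in at_right 0. norm (\<Psi> h (U (tn + h)) - U (tn + h)) \<le> N * h ^ 5"
    using small Ustar_err Ustar[OF half_pos order_refl] tendstoD[OF lim_half half_pos]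
  proof eventually_elim
    case (elim h)
    let ?u = "U (tn + h/2)"
    have h: "0 \<le> h" "h \<le> 1" "h \<le> t1 - tn" "h\<^sup>2 \<le> 1" using elim(1) by (auto simp: power_le_one)
    have close: "dist ?u (U tn) < R/2" by (rule elim(4))
    have "Ustar h \<in> ball ?u (R/2)" using elim(3) by blast
    then have mem: "Ustar h \<in> ?K" "?u \<in> ?K"
      using close dist_triangle[of "U tn" "Ustar h" ?u] R(1) by (auto simp: dist_commute)
    have perturb: "norm (f (Ustar h) - f ?u) \<le> B * (6 * M * h ^ 5)" if "B-lipschitz_on ?K f" for f :: "real^'n \<Rightarrow> real^'n"
    proof -
      have "norm (f (Ustar h) - f ?u) \<le> B * norm (Ustar h - ?u)"
        using lipschitz_onD[OF that mem] by (simp add: dist_norm)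
      also have "\<dots> \<le> B * (6 * M * h ^ 5)" using elim(2) B0 by (intro mult_left_mono) auto
      finally show ?thesis .
    qed
    let ?d = "U tn + h *\<^sub>R (a0 C *\<^sub>R L (U tn) + a1 C *\<^sub>R L ?u + a2 C *\<^sub>R L (U (tn + h)))
      + (C * h\<^sup>2) *\<^sub>R (?G (U tn) - ?G ?u - (3/2) *\<^sub>R ?G (U (tn + h))) - U (tn + h)"
    have eq: "\<Psi> h (U (tn + h)) - U (tn + h) = ?d + (a1 C * h) *\<^sub>R (L (Ustar h) - L ?u)
        - (C * h\<^sup>2) *\<^sub>R (?G (Ustar h) - ?G ?u)"
      by (simp add: \<Psi> algebra_simps)
    have "norm (\<Psi> h (U (tn + h)) - U (tn + h)) \<le> norm ?d + \<bar>a1 C * h\<bar> * norm (L (Ustar h) - L ?u)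
        + \<bar>C * h\<^sup>2\<bar> * norm (?G (Ustar h) - ?G ?u)"
      unfolding eq norm_scaleR[symmetric]
      by (rule order_trans[OF norm_triangle_ineq4 add_mono[OF norm_triangle_ineq order_refl]])
    also have "\<dots> \<le> A * M * h ^ 5 + \<bar>a1 C\<bar> * (B * (6 * M * h ^ 5)) + \<bar>C\<bar> * (B * (6 * M * h ^ 5))"
      using h quadrature2[OF h(1,3), of C]
      by (intro add_mono mult_mono perturb B)
         (auto simp: A_def abs_mult mult_left_le)
    finally show ?case by (simp add: N_def algebra_simps)
  qed
  ultimately obtain Unew where
    Unew: "\<And>r. 0 < r \<Longrightarrow> r \<le> R/2 \<Longrightarrow>
      \<forall>\<^sub>F h in at_right 0. {x \<in> ball (U (tn + h)) r. x = \<Psi> h x} = {Unew h}" and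
    Unew_err: "\<forall>\<^sub>F h in at_right 0. norm (Unew h - U (tn + h)) \<le> 2 * (N * h ^ 5)"
    using perturbed_fixed_point[OF R(1) lim_full _ _ lim5] by blast

  show ?thesis
  proof (intro exI conjI ballI)
    \<comment> \<open>Half of \<open>R\<close> leaves room for the moving centres, which are
      eventually within \<open>R/2\<close> of \<open>U tn\<close>; the balls about them then stay in
      \<open>?K\<close>.\<close>
    show "0 < R/2" by (rule half_pos)
    have ball_sub: "ball y (R/2) \<subseteq> S" if "dist y (U tn) < R/2" for y
    proof
      fix x assume "x \<in> ball y (R/2)"
      then show "x \<in> S"
        using that R(2) dist_triangle[of "U tn" x y] by (auto simp: dist_commute)
    qed
    show "\<forall>\<^sub>F h in at_right 0. ball (U (tn + h/2)) (R/2) \<subseteq> S \<and> ball (U (tn + h)) (R/2) \<subseteq> S"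
      using tendstoD[OF lim_half half_pos] tendstoD[OF lim_full half_pos]
      by eventually_elim (simp add: ball_sub)
    show "\<forall>\<^sub>F h in at_right 0.
        {us \<in> ball (U (tn + h/2)) r. first_stage L h (U tn) us} = {Ustar h} \<and>
        {un \<in> ball (U (tn + h)) r. second_stage C L h (U tn) (Ustar h) un} = {Unew h}"
      if "r \<in> {0<..R/2}" for r
      using Ustar[of r] Unew[of r] that by (simp add: stage1 stage2 eventually_conj)
    show "(\<lambda>h. norm (Unew h - U (tn + h))) \<in> O[at_right 0](\<lambda>h. h ^ 5)"
    proof (rule bigoI)
      show "\<forall>\<^sub>F h in at_right 0. norm (norm (Unew h - U (tn + h))) \<le> 2 * N * norm (h ^ 5)"
        using Unew_err small by eventually_elim simp
    qed
  qed
qed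

end
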